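(* Let $A=(a_{ij})\in\mathbb{R}^{s\times s}$ and $b=(b_j)\in\mathbb{R}^s$ be the coefficients of a Runge--Kutta method of order at least two, and let $\langle\cdot,\cdot\rangle$ be an inner product on $\mathbb{R}^m$ with norm $\|\cdot\|$. Consider the corresponding relaxation Runge--Kutta method with stages $$y_i = u^n+\Delta t\sum_{j=1}^s a_{ij} f_j,\qquad f_j=f(t_n+c_j\Delta t,y_j),\qquad i=1,\dots,s,$$ and update $$u^{n+1}_\gamma = u^n+\gamma_n\,\Delta t\sum_{j=1}^s b_j f_j,$$ where $$\gamma_n=\begin{cases}1 & \text{if } \bigl\|\sum_{j=1}^s b_jf_j\bigr\|^2=0,\\[1ex] \dfrac{2\sum_{i,j=1}^s b_ia_{ij}\langle f_i,f_j\rangle}{\sum_{i,j=1}^s b_ib_j\langle f_i,f_j\rangle} & \text{if } \bigl\|\sum_{j=1}^s b_jf_j\bigr\|^2\neq 0.\end{cases}$$ Then the relaxation method is conservative: for every problem $u'(t)=f(t,u(t))$ satisfying $\langle u,f(t,u)\rangle=0$ for all $t,u$, one has $\|u^{n+1}_\gamma\|=\|u^n\|$. If moreover the weights are nonnegative ($b_j\ge 0$ for all $j$), then the relaxation method is also monotonicity preserving as long as $\Delta t$ is chosen so that $\gamma_n\ge 0$: for every problem satisfying $\langle u,f(t,u)\rangle\le 0$ for all $t,u$, and every such $\Delta t$, one has $\|u^{n+1}_\gamma\|\le\|u^n\|$.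
   Context: The initial value problem is $u'(t)=f(t,u(t))$, $u(t_0)=u_0$, with $u:\mathbb{R}\to\mathbb{R}^m$ and $f:\mathbb{R}\times\mathbb{R}^m\to\mathbb{R}^m$. $\Delta t>0$ is the step size, and $c_i=\sum_{j} a_{ij}$. The underlying $s$-stage Runge--Kutta method $(A,b)$ uses the same stages with the update $u^{n+1}=u^n+\Delta t\sum_j b_j f_j$. It may be explicit or implicit; in the implicit case $y_1,\dots,y_s$ denotes a solution of the stage equations. A Runge--Kutta method has order (at least) $p$ if for every problem with sufficiently smooth $f$, starting from exact data $u^n=u(t_n)$, one has $\|u^{n+1}-u(t_n+\Delta t)\|=O(\Delta t^{p+1})$ as $\Delta t\to0$. *)

theory Defs
  imports "HOL-Analysis.Analysis" "HOL-Library.Landau_Symbols"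
begin

definition inner_product :: "(real^'m \<Rightarrow> real^'m \<Rightarrow> real) \<Rightarrow> bool" where
  "inner_product ip \<longleftrightarrow>
     bilinear ip \<and> (\<forall>x y. ip x y = ip y x) \<and> (\<forall>x. x \<noteq> 0 \<longrightarrow> ip x x > 0)"

definition ip_norm :: "(real^'m \<Rightarrow> real^'m \<Rightarrow> real) \<Rightarrow> real^'m \<Rightarrow> real" where
  "ip_norm ip x = sqrt (ip x x)"

text \<open>Functions of class \<open>C\<^sup>k\<close> on a whole (finite-dimensional) space: all directional derivatives
  of the total derivative are again of class \<open>C\<^sup>k\<^sup>-\<^sup>1\<close>.\<close>

primrec Ck_fun :: "nat \<Rightarrow> ('a::euclidean_space \<Rightarrow> 'b::real_normed_vector) \<Rightarrow> bool" where
  "Ck_fun 0 g \<longleftrightarrow> continuous_on UNIV g"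
| "Ck_fun (Suc k) g \<longleftrightarrow>
     (\<forall>x. g differentiable (at x)) \<and> (\<forall>v. Ck_fun k (\<lambda>x. frechet_derivative g (at x) v))"

definition solves_on :: "(real \<Rightarrow> real^'m) \<Rightarrow> (real \<Rightarrow> real^'m \<Rightarrow> real^'m) \<Rightarrow> real set \<Rightarrow> bool" where
  "solves_on u f S \<longleftrightarrow> (\<forall>t\<in>S. (u has_vector_derivative f t (u t)) (at t within S))"

definition rk_nodes :: "real^'s^'s \<Rightarrow> real^'s" where
  "rk_nodes A = (\<chi> i. \<Sum>j\<in>UNIV. A $ i $ j)"

definition rk_slopes ::
  "real^'s^'s \<Rightarrow> (real \<Rightarrow> real^'m \<Rightarrow> real^'m) \<Rightarrow> real \<Rightarrow> real \<Rightarrow> ('s \<Rightarrow> real^'m) \<Rightarrow> 's \<Rightarrow> real^'m" where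
  "rk_slopes A f t h y = (\<lambda>j. f (t + rk_nodes A $ j * h) (y j))"

text \<open>For an implicit method the stage equations need not determine \<open>y\<close>, so being a stage vector is
  a relation.\<close>

definition rk_stages ::
  "real^'s^'s \<Rightarrow> (real \<Rightarrow> real^'m \<Rightarrow> real^'m) \<Rightarrow> real \<Rightarrow> real^'m \<Rightarrow> real \<Rightarrow> ('s \<Rightarrow> real^'m) \<Rightarrow> bool" where
  "rk_stages A f t u h y \<longleftrightarrow>
     (\<forall>i. y i = u + h *\<^sub>R (\<Sum>j\<in>UNIV. A $ i $ j *\<^sub>R rk_slopes A f t h y j))"

definition rk_increment :: "real^'s \<Rightarrow> ('s \<Rightarrow> real^'m) \<Rightarrow> real^'m" where
  "rk_increment b F = (\<Sum>j\<in>UNIV. b $ j *\<^sub>R F j)"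

definition rk_step ::
  "real^'s^'s \<Rightarrow> real^'s \<Rightarrow> (real \<Rightarrow> real^'m \<Rightarrow> real^'m) \<Rightarrow> real \<Rightarrow> real^'m \<Rightarrow> real \<Rightarrow>
   ('s \<Rightarrow> real^'m) \<Rightarrow> real^'m" where
  "rk_step A b f t u h y = u + h *\<^sub>R rk_increment b (rk_slopes A f t h y)"

text \<open>Order at least \<open>p\<close>, for systems in \<open>\<real>\<^sup>m\<close> where \<open>m\<close> is the cardinality of the index type \<open>'m\<close>.
  The exact solution \<open>u\<close> is only required to exist locally to the right of \<open>t\<close>. For an implicit
  method the stage equations may have spurious solutions that stay away from \<open>u t\<close> as the step size
  tends to \<open>0\<close> (the implicit midpoint rule applied to \<open>u' = u\<^sup>2\<close> has one of size about \<open>2/h\<close>); the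
  requirement that all stages tend to \<open>u t\<close> excludes these. For explicit methods that
  requirement holds automatically.\<close>

definition rk_order_at_least ::
  "'m::finite itself \<Rightarrow> real^'s^'s \<Rightarrow> real^'s \<Rightarrow> nat \<Rightarrow> bool" where
  "rk_order_at_least (_ :: 'm itself) A b p \<longleftrightarrow>
     (\<exists>k. \<forall>(f :: real \<Rightarrow> real^'m \<Rightarrow> real^'m) u t \<epsilon> (y :: real \<Rightarrow> 's \<Rightarrow> real^'m).
        Ck_fun k (\<lambda>(t, x). f t x) \<longrightarrow>
        \<epsilon> > 0 \<longrightarrow> solves_on u f {t..t + \<epsilon>} \<longrightarrow>
        (\<forall>\<^sub>F h in at_right 0. rk_stages A f t (u t) h (y h)) \<longrightarrow>
        (\<forall>i. ((\<lambda>h. y h i) \<longlongrightarrow> u t) (at_right 0)) \<longrightarrow>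
        (\<lambda>h. norm (rk_step A b f t (u t) h (y h) - u (t + h))) \<in> O[at_right 0](\<lambda>h. h ^ (p + 1)))"

definition relaxation_gamma ::
  "(real^'m \<Rightarrow> real^'m \<Rightarrow> real) \<Rightarrow> real^'s^'s \<Rightarrow> real^'s \<Rightarrow> ('s \<Rightarrow> real^'m) \<Rightarrow> real" where
  "relaxation_gamma ip A b F =
     (if (ip_norm ip (rk_increment b F))\<^sup>2 = 0 then 1
      else 2 * (\<Sum>i\<in>UNIV. \<Sum>j\<in>UNIV. b $ i * A $ i $ j * ip (F i) (F j)) /
           (\<Sum>i\<in>UNIV. \<Sum>j\<in>UNIV. b $ i * b $ j * ip (F i) (F j)))"

definition relaxation_step ::
  "(real^'m \<Rightarrow> real^'m \<Rightarrow> real) \<Rightarrow> real^'s^'s \<Rightarrow> real^'s \<Rightarrow> (real \<Rightarrow> real^'m \<Rightarrow> real^'m) \<Rightarrow>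
   real \<Rightarrow> real^'m \<Rightarrow> real \<Rightarrow> ('s \<Rightarrow> real^'m) \<Rightarrow> real^'m" where
  "relaxation_step ip A b f t u h y =
     u + (relaxation_gamma ip A b (rk_slopes A f t h y) * h) *\<^sub>R rk_increment b (rk_slopes A f t h y)"

end

theory Submission
  imports Defs
begin

text \<open>
  Write \<open>F\<close> for the vector of stage slopes, \<open>y\<close> for the stages, \<open>d = \<Sum>\<^sub>j b\<^sub>j F\<^sub>j\<close> for the
  increment and \<open>h\<close> for the step size. Expanding the square gives
  \<open>\<parallel>u + \<gamma> h d\<parallel>\<^sup>2 = \<parallel>u\<parallel>\<^sup>2 + 2 \<gamma> h \<langle>u, d\<rangle> + \<gamma>\<^sup>2 h\<^sup>2 \<parallel>d\<parallel>\<^sup>2\<close>. The problem only controls inner products of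
  a slope with its own stage, so \<open>u\<close> is replaced, in the \<open>j\<close>-th term of \<open>\<langle>u, d\<rangle>\<close>, by
  \<open>y\<^sub>j - h \<Sum>\<^sub>k a\<^sub>j\<^sub>k F\<^sub>k\<close>. This leaves the terms \<open>b\<^sub>j \<langle>y\<^sub>j, F\<^sub>j\<rangle>\<close> and a defect
  \<open>\<gamma> h\<^sup>2 (\<gamma> \<parallel>d\<parallel>\<^sup>2 - 2 \<Sum>\<^sub>j\<^sub>k b\<^sub>j a\<^sub>j\<^sub>k \<langle>F\<^sub>j, F\<^sub>k\<rangle>)\<close>, and \<open>\<gamma>\<^sub>n\<close> is precisely the factor that makes the
  defect vanish when \<open>d \<noteq> 0\<close>. Hence, in that case,
  \<open>\<parallel>u\<^sub>\<gamma>\<parallel>\<^sup>2 = \<parallel>u\<parallel>\<^sup>2 + 2 \<gamma>\<^sub>n h \<Sum>\<^sub>j b\<^sub>j \<langle>y\<^sub>j, F\<^sub>j\<rangle>\<close>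
  (lemma \<open>relaxation_energy_balance\<close>). For a conservative problem every \<open>\<langle>y\<^sub>j, F\<^sub>j\<rangle>\<close> is zero; for a
  dissipative one they are nonpositive, and nonnegative weights together with \<open>\<gamma>\<^sub>n \<ge> 0\<close> give the
  inequality. In the remaining case \<open>d = 0\<close> the step does not move, whatever
  the relaxation factor is.
\<close>

lemma inner_product_bilinear: "inner_product ip \<Longrightarrow> bilinear ip"
  by (simp add: inner_product_def)

lemma inner_product_commute: "inner_product ip \<Longrightarrow> ip x y = ip y x"
  by (simp add: inner_product_def)

lemma inner_product_self_eq_0_iff:
  assumes "inner_product ip"
  shows "ip x x = 0 \<longleftrightarrow> x = 0"
  using assms bilinear_lzero[of ip] unfolding inner_product_def by (metis less_irrefl)

lemma inner_product_self_nonneg: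
  assumes "inner_product ip"
  shows "ip x x \<ge> 0"
  using assms inner_product_self_eq_0_iff[OF assms, of x] unfolding inner_product_def
  by (metis less_eq_real_def)

lemma ip_norm_power2:
  assumes "inner_product ip"
  shows "(ip_norm ip x)\<^sup>2 = ip x x"
  by (simp add: ip_norm_def inner_product_self_nonneg[OF assms])

lemma bilinear_weighted_sum_left:
  fixes ip :: "real^'m \<Rightarrow> real^'m \<Rightarrow> real"
  assumes "bilinear ip"
  shows "ip (\<Sum>j\<in>S. c j *\<^sub>R F j) x = (\<Sum>j\<in>S. c j * ip (F j) x)"
proof -
  have "linear (\<lambda>v. ip v x)"
    using assms by (simp add: bilinear_def)
  then show ?thesis
    using linear_sum[of "\<lambda>v. ip v x" "\<lambda>j. c j *\<^sub>R F j" S]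
    by (simp add: bilinear_lmul[OF assms])
qed

lemma bilinear_weighted_sum_right:
  fixes ip :: "real^'m \<Rightarrow> real^'m \<Rightarrow> real"
  assumes "bilinear ip"
  shows "ip x (\<Sum>j\<in>S. c j *\<^sub>R F j) = (\<Sum>j\<in>S. c j * ip x (F j))"
proof -
  have "linear (ip x)"
    using assms by (simp add: bilinear_def)
  then show ?thesis
    by (simp add: linear_sum linear_cmul)
qed

lemma inner_product_square_add_scaleR:
  fixes ip :: "real^'m \<Rightarrow> real^'m \<Rightarrow> real"
  assumes "inner_product ip"
  shows "ip (u + c *\<^sub>R d) (u + c *\<^sub>R d) = ip u u + 2 * c * ip u d + c\<^sup>2 * ip d d"
proof -
  note bil = inner_product_bilinear[OF assms]
  show ?thesis
    using inner_product_commute[OF assms, of d u]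
    by (simp add: bilinear_ladd[OF bil] bilinear_radd[OF bil] bilinear_lmul[OF bil]
        bilinear_rmul[OF bil] power2_eq_square algebra_simps)
qed

text \<open>
  By bilinearity the denominator of the relaxation factor is \<open>\<parallel>d\<parallel>\<^sup>2\<close> for the increment \<open>d\<close>, and by
  definiteness it is nonzero, so the quotient can be multiplied out. For \<open>d = 0\<close> the factor is \<open>1\<close>
  by convention and the quadratic form on the right may be nonzero.
\<close>

lemma relaxation_gamma_cancels:
  fixes ip :: "real^'m \<Rightarrow> real^'m \<Rightarrow> real"
  assumes "inner_product ip" and "rk_increment b F \<noteq> 0"
  shows "relaxation_gamma ip A b F * ip (rk_increment b F) (rk_increment b F) =
    2 * (\<Sum>i\<in>UNIV. \<Sum>j\<in>UNIV. b $ i * A $ i $ j * ip (F i) (F j))"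
proof -
  note bil = inner_product_bilinear[OF assms(1)]
  have "ip (rk_increment b F) (rk_increment b F) =
      (\<Sum>i\<in>UNIV. \<Sum>j\<in>UNIV. b $ i * b $ j * ip (F i) (F j))"
    unfolding rk_increment_def
    by (subst bilinear_weighted_sum_left[OF bil])
      (simp add: bilinear_weighted_sum_right[OF bil] sum_distrib_left mult.assoc)
  moreover have "ip (rk_increment b F) (rk_increment b F) \<noteq> 0"
    using assms by (simp add: inner_product_self_eq_0_iff)
  ultimately show ?thesis
    by (simp add: relaxation_gamma_def ip_norm_power2[OF assms(1)])
qed

text \<open>
  Each slope is paired with the stage at which it was evaluated, because that pairing is what the
  sign condition on \<open>f\<close> speaks about; the price is the quadratic form of the coefficients \<open>b\<^sub>i a\<^sub>i\<^sub>j\<close>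
  in the numerator of the relaxation factor.
\<close>

lemma inner_product_increment:
  fixes ip :: "real^'m \<Rightarrow> real^'m \<Rightarrow> real"
  assumes "inner_product ip" and "rk_stages A f t u h y"
  defines "F \<equiv> rk_slopes A f t h y"
  shows "ip u (rk_increment b F) =
    (\<Sum>j\<in>UNIV. b $ j * ip (y j) (F j))
      - h * (\<Sum>i\<in>UNIV. \<Sum>j\<in>UNIV. b $ i * A $ i $ j * ip (F i) (F j))"
proof -
  note bil = inner_product_bilinear[OF assms(1)]
  have stage: "ip u (F i) = ip (y i) (F i) - h * (\<Sum>j\<in>UNIV. A $ i $ j * ip (F i) (F j))" for i
  proof -
    have "y i = u + h *\<^sub>R (\<Sum>j\<in>UNIV. A $ i $ j *\<^sub>R F j)"
      using assms(2) by (simp add: rk_stages_def F_def)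
    then have "ip (y i) (F i) = ip u (F i) + h * (\<Sum>j\<in>UNIV. A $ i $ j * ip (F j) (F i))"
      by (simp add: bilinear_ladd[OF bil] bilinear_lmul[OF bil] bilinear_weighted_sum_left[OF bil])
    then show ?thesis
      by (simp add: inner_product_commute[OF assms(1), of _ "F i"])
  qed
  have "ip u (rk_increment b F) = (\<Sum>i\<in>UNIV. b $ i * ip u (F i))"
    by (simp add: rk_increment_def bilinear_weighted_sum_right[OF bil])
  then show ?thesis
    by (simp add: stage right_diff_distrib sum_subtractf sum_distrib_left mult_ac)
qed

text \<open>
  The relaxation factor turns the term quadratic in the step size, \<open>\<gamma>\<^sup>2 h\<^sup>2 \<parallel>d\<parallel>\<^sup>2\<close>, into \<open>2 \<gamma> h\<^sup>2 Q\<close>,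
  with \<open>Q\<close> the quadratic form of the coefficients \<open>b\<^sub>i a\<^sub>i\<^sub>j\<close>; the cross term contributes \<open>-2 \<gamma> h\<^sup>2 Q\<close>.
  What remains is the exact energy exchange at the stages.
\<close>

lemma relaxation_energy_balance:
  fixes ip :: "real^'m \<Rightarrow> real^'m \<Rightarrow> real"
  assumes "inner_product ip" and "rk_stages A f t u h y"
  defines "F \<equiv> rk_slopes A f t h y"
  assumes "rk_increment b F \<noteq> 0"
  shows "(ip_norm ip (relaxation_step ip A b f t u h y))\<^sup>2 =
    (ip_norm ip u)\<^sup>2 + 2 * (relaxation_gamma ip A b F * h) * (\<Sum>j\<in>UNIV. b $ j * ip (y j) (F j))"
proof -
  define g where "g = relaxation_gamma ip A b F"
  define d where "d = rk_increment b F"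
  define Q where "Q = (\<Sum>i\<in>UNIV. \<Sum>j\<in>UNIV. b $ i * A $ i $ j * ip (F i) (F j))"
  define E where "E = (\<Sum>j\<in>UNIV. b $ j * ip (y j) (F j))"
  have gamma: "g * ip d d = 2 * Q"
    unfolding g_def d_def Q_def by (rule relaxation_gamma_cancels[OF assms(1,4)])
  have increment: "ip u d = E - h * Q"
    unfolding d_def E_def Q_def F_def by (rule inner_product_increment[OF assms(1,2)])
  have "(ip_norm ip (relaxation_step ip A b f t u h y))\<^sup>2 = ip (u + (g * h) *\<^sub>R d) (u + (g * h) *\<^sub>R d)"
    by (simp add: ip_norm_power2[OF assms(1)] relaxation_step_def g_def d_def F_def)
  also have "\<dots> = ip u u + 2 * (g * h) * ip u d + g * h\<^sup>2 * (g * ip d d)"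
    by (simp add: inner_product_square_add_scaleR[OF assms(1)] power2_eq_square mult_ac)
  also have "\<dots> = ip u u + 2 * (g * h) * E"
    unfolding gamma increment by (simp add: power2_eq_square algebra_simps)
  finally show ?thesis
    by (simp add: ip_norm_power2[OF assms(1)] g_def E_def)
qed

lemma relaxation_step_eq_self:
  assumes "rk_increment b (rk_slopes A f t h y) = 0"
  shows "relaxation_step ip A b f t u h y = u"
  using assms by (simp add: relaxation_step_def)

lemma relaxation_step_conservative:
  fixes ip :: "real^'m \<Rightarrow> real^'m \<Rightarrow> real"
  assumes "inner_product ip" and "rk_stages A f t u h y" and "\<And>t u. ip u (f t u) = 0"
  shows "ip_norm ip (relaxation_step ip A b f t u h y) = ip_norm ip u"
proof (cases "rk_increment b (rk_slopes A f t h y) = 0")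
  case True
  then show ?thesis by (simp add: relaxation_step_eq_self)
next
  case False
  have "ip (y j) (rk_slopes A f t h y j) = 0" for j
    by (simp add: rk_slopes_def assms(3))
  then have "(ip_norm ip (relaxation_step ip A b f t u h y))\<^sup>2 = (ip_norm ip u)\<^sup>2"
    by (simp add: relaxation_energy_balance[OF assms(1,2) False])
  then show ?thesis
    by (simp add: ip_norm_def inner_product_self_nonneg[OF assms(1)])
qed

lemma relaxation_step_monotone:
  fixes ip :: "real^'m \<Rightarrow> real^'m \<Rightarrow> real"
  assumes "inner_product ip" and "rk_stages A f t u h y" and "\<And>t u. ip u (f t u) \<le> 0"
    and "\<And>j. b $ j \<ge> 0" and "h \<ge> 0"
    and "relaxation_gamma ip A b (rk_slopes A f t h y) \<ge> 0"
  shows "ip_norm ip (relaxation_step ip A b f t u h y) \<le> ip_norm ip u"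
proof (cases "rk_increment b (rk_slopes A f t h y) = 0")
  case True
  then show ?thesis by (simp add: relaxation_step_eq_self)
next
  case False
  have "ip (y j) (rk_slopes A f t h y j) \<le> 0" for j
    by (simp add: rk_slopes_def assms(3))
  then have "(\<Sum>j\<in>UNIV. b $ j * ip (y j) (rk_slopes A f t h y j)) \<le> 0"
    by (intro sum_nonpos mult_nonneg_nonpos assms(4))
  then have "2 * (relaxation_gamma ip A b (rk_slopes A f t h y) * h) *
      (\<Sum>j\<in>UNIV. b $ j * ip (y j) (rk_slopes A f t h y j)) \<le> 0"
    using assms(5,6) by (intro mult_nonneg_nonpos) auto
  then have "(ip_norm ip (relaxation_step ip A b f t u h y))\<^sup>2 \<le> (ip_norm ip u)\<^sup>2"
    using relaxation_energy_balance[OF assms(1,2) False] by linarith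
  then show ?thesis
    by (simp add: ip_norm_def inner_product_self_nonneg[OF assms(1)])
qed

theorem theorem2:
  fixes A :: "real^'s^'s" and b :: "real^'s"
    and ip :: "real^'m \<Rightarrow> real^'m \<Rightarrow> real"
  assumes "rk_order_at_least TYPE('m) A b 2"
    and "inner_product ip"
  shows "(\<forall>(f :: real \<Rightarrow> real^'m \<Rightarrow> real^'m) t\<^sub>n u\<^sub>n \<Delta>t y.
            (\<forall>t u. ip u (f t u) = 0) \<longrightarrow> \<Delta>t > 0 \<longrightarrow> rk_stages A f t\<^sub>n u\<^sub>n \<Delta>t y \<longrightarrow>
            ip_norm ip (relaxation_step ip A b f t\<^sub>n u\<^sub>n \<Delta>t y) = ip_norm ip u\<^sub>n)
       \<and> ((\<forall>j. b $ j \<ge> 0) \<longrightarrow>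
          (\<forall>(f :: real \<Rightarrow> real^'m \<Rightarrow> real^'m) t\<^sub>n u\<^sub>n \<Delta>t y.
            (\<forall>t u. ip u (f t u) \<le> 0) \<longrightarrow> \<Delta>t > 0 \<longrightarrow> rk_stages A f t\<^sub>n u\<^sub>n \<Delta>t y \<longrightarrow>
            relaxation_gamma ip A b (rk_slopes A f t\<^sub>n \<Delta>t y) \<ge> 0 \<longrightarrow>
            ip_norm ip (relaxation_step ip A b f t\<^sub>n u\<^sub>n \<Delta>t y) \<le> ip_norm ip u\<^sub>n))"
  using relaxation_step_conservative[OF assms(2)] relaxation_step_monotone[OF assms(2)]
  by (meson less_imp_le)

end
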